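(* Let $\mathcal{H}$ be an infinite-dimensional separable real Hilbert space. Then there is a family, of the cardinality of the continuum, of pairwise non-similar Lomonosov algebras of quaternion type on $\mathcal{H}$.
   Context: $\mathcal{B}(\mathcal{X})$ is the algebra of all bounded linear operators on a real Banach space $\mathcal{X}$; SOT is the strong operator topology. A subalgebra of $\mathcal{B}(\mathcal{X})$ is transitive if it has no non-trivial closed invariant subspaces. A Lomonosov algebra is an SOT-closed transitive subalgebra of $\mathcal{B}(\mathcal{X})$ containing a non-zero compact operator; every Lomonosov algebra contains a non-zero finite rank operator. For a Lomonosov algebra $\mathcal{A}$, $\mathcal{A}^F$ is the set of all finite rank operators in $\mathcal{A}$, $\mathcal{X}^F=\mathrm{lin}\{Tx: T\in\mathcal{A}^F, x\in\mathcal{X}\}$, and $\mathbb{D}$ is the algebra of all linear operators $\mathcal{X}^F\to\mathcal{X}^F$ (not assumed bounded) commuting with the restrictions to $\mathcal{X}^F$ of all operators in $\mathcal{A}^F$. When $\mathcal{X}$ is infinite-dimensional, $\mathbb{D}$ is always isomorphic to $\mathbb{R}$, $\mathbb{C}$ or the quaternions $\mathbb{H}$, and $\mathcal{A}$ is said to be of real, complex or quaternion type, respectively. Two algebras $\mathcal{A}_1,\mathcal{A}_2\subset\mathcal{B}(\mathcal{H})$ are similar if $T\mathcal{A}_1T^{-1}=\mathcal{A}_2$ for some bounded invertible operator $T$ on $\mathcal{H}$. *)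

theory Defs
  imports "HOL-Analysis.Analysis"
begin

datatype quaternion = Quat (qre: real) (qi: real) (qj: real) (qk: real)

instantiation quaternion :: real_algebra_1
begin

definition "0 = Quat 0 0 0 0"
definition "1 = Quat 1 0 0 0"
definition "x + y = Quat (qre x + qre y) (qi x + qi y) (qj x + qj y) (qk x + qk y)"
definition "- x = Quat (- qre x) (- qi x) (- qj x) (- qk x)"
definition "x - y = Quat (qre x - qre y) (qi x - qi y) (qj x - qj y) (qk x - qk y)"
definition "r *\<^sub>R x = Quat (r * qre x) (r * qi x) (r * qj x) (r * qk x)"
definition "x * y = Quat
  (qre x * qre y - qi x * qi y - qj x * qj y - qk x * qk y)
  (qre x * qi y + qi x * qre y + qj x * qk y - qk x * qj y)
  (qre x * qj y - qi x * qk y + qj x * qre y + qk x * qi y)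
  (qre x * qk y + qi x * qj y - qj x * qi y + qk x * qre y)"

instance
  by standard
    (simp_all add: zero_quaternion_def one_quaternion_def plus_quaternion_def uminus_quaternion_def
      minus_quaternion_def scaleR_quaternion_def times_quaternion_def algebra_simps)

end

lemma quaternion_units:
  defines "i \<equiv> Quat 0 1 0 0" and "j \<equiv> Quat 0 0 1 0" and "k \<equiv> Quat 0 0 0 1"
  shows "i * i = - 1" and "j * j = - 1" and "k * k = - 1" and "i * j * k = - 1"
  by (simp_all add: i_def j_def k_def times_quaternion_def one_quaternion_def uminus_quaternion_def)

definition finite_dim :: "'a::real_vector set \<Rightarrow> bool" where
  "finite_dim V \<longleftrightarrow> (\<exists>B. finite B \<and> span B = V)"

definition compact_operator :: "('a::banach \<Rightarrow>\<^sub>L 'a) \<Rightarrow> bool" where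
  "compact_operator T \<longleftrightarrow> compact (closure (blinfun_apply T ` cball 0 1))"

(* Subalgebras are not required to contain the identity operator. *)
definition operator_subalgebra :: "('a::banach \<Rightarrow>\<^sub>L 'a) set \<Rightarrow> bool" where
  "operator_subalgebra \<A> \<longleftrightarrow> subspace \<A> \<and> (\<forall>S\<in>\<A>. \<forall>T\<in>\<A>. S o\<^sub>L T \<in> \<A>)"

definition transitive_algebra :: "('a::banach \<Rightarrow>\<^sub>L 'a) set \<Rightarrow> bool" where
  "transitive_algebra \<A> \<longleftrightarrow>
     (\<forall>M. subspace M \<and> closed M \<and> (\<forall>T\<in>\<A>. blinfun_apply T ` M \<subseteq> M) \<longrightarrow> M = {0} \<or> M = UNIV)"

definition lomonosov_algebra :: "('a::banach \<Rightarrow>\<^sub>L 'a) set \<Rightarrow> bool" where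
  "lomonosov_algebra \<A> \<longleftrightarrow>
     operator_subalgebra \<A> \<and> closedin strong_operator_topology \<A> \<and> transitive_algebra \<A> \<and>
     (\<exists>K\<in>\<A>. K \<noteq> 0 \<and> compact_operator K)"

definition finite_rank_part :: "('a::banach \<Rightarrow>\<^sub>L 'a) set \<Rightarrow> ('a \<Rightarrow>\<^sub>L 'a) set" where
  "finite_rank_part \<A> = {T \<in> \<A>. finite_dim (range (blinfun_apply T))}"

definition finite_rank_space :: "('a::banach \<Rightarrow>\<^sub>L 'a) set \<Rightarrow> 'a set" where
  "finite_rank_space \<A> = span {blinfun_apply T x | T x. T \<in> finite_rank_part \<A>}"

(* Operators on the subspace are represented by functions that are undefined outside it,
   so that distinct elements of the commutant are distinct operators.
   No boundedness is imposed. *)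
definition finite_rank_commutant :: "('a::banach \<Rightarrow>\<^sub>L 'a) set \<Rightarrow> ('a \<Rightarrow> 'a) set" where
  "finite_rank_commutant \<A> =
     {D \<in> finite_rank_space \<A> \<rightarrow>\<^sub>E finite_rank_space \<A>.
        (\<forall>x\<in>finite_rank_space \<A>. \<forall>y\<in>finite_rank_space \<A>. D (x + y) = D x + D y) \<and>
        (\<forall>r. \<forall>x\<in>finite_rank_space \<A>. D (r *\<^sub>R x) = r *\<^sub>R D x) \<and>
        (\<forall>T\<in>finite_rank_part \<A>. \<forall>x\<in>finite_rank_space \<A>.
           D (blinfun_apply T x) = blinfun_apply T (D x))}"

(* The commutant is isomorphic, as a real algebra, to the quaternions.  The sum and scalar
   multiple of operators are pointwise on the subspace, their product is composition. *)
definition quaternion_type :: "('a::banach \<Rightarrow>\<^sub>L 'a) set \<Rightarrow> bool" where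
  "quaternion_type \<A> \<longleftrightarrow>
     (\<exists>\<phi> :: quaternion \<Rightarrow> 'a \<Rightarrow> 'a.
        bij_betw \<phi> UNIV (finite_rank_commutant \<A>) \<and>
        (\<forall>p q. \<phi> (p + q) = (\<lambda>x\<in>finite_rank_space \<A>. \<phi> p x + \<phi> q x)) \<and>
        (\<forall>r p. \<phi> (r *\<^sub>R p) = (\<lambda>x\<in>finite_rank_space \<A>. r *\<^sub>R \<phi> p x)) \<and>
        (\<forall>p q. \<phi> (p * q) = compose (finite_rank_space \<A>) (\<phi> p) (\<phi> q)))"

definition similar_algebras :: "('a::banach \<Rightarrow>\<^sub>L 'a) set \<Rightarrow> ('a \<Rightarrow>\<^sub>L 'a) set \<Rightarrow> bool" where
  "similar_algebras \<A>\<^sub>1 \<A>\<^sub>2 \<longleftrightarrow>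
     (\<exists>T S. T o\<^sub>L S = id_blinfun \<and> S o\<^sub>L T = id_blinfun \<and> (\<lambda>A. T o\<^sub>L A o\<^sub>L S) ` \<A>\<^sub>1 = \<A>\<^sub>2)"

end

theory Submission
  imports Defs
begin

text \<open>
  Group an orthonormal basis of the space into blocks of four vectors \<open>e n 0, \<dots>, e n 3\<close> and read each
  block as a copy of the quaternions in which \<open>e n 0\<close> stands for 1 and \<open>b n * e n 1\<close>, \<open>b n * e n 2\<close>,
  \<open>b n * e n 3\<close> stand for the three units, where \<open>b n \<ge> 1\<close> is a weight. Left multiplication by
  \<open>i\<close> in the block \<open>n\<close> then has norm \<open>b n\<close>, so for an unbounded sequence of weights the left
  multiplications on the whole space are unbounded and only densely defined. The bounded operators
  commuting with all of them nevertheless form a large algebra: it contains every matrix entry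
  (right multiplication followed by a transfer from one block to another), which makes it
  transitive and supplies compact operators, and the commutation conditions are closed in
  the strong operator topology (\<open>lomonosov_commuting_operators\<close>). A map commuting with
  the matrix entries is determined by its value at one vector and is a left multiplication; since
  left multiplications preserve the span of the ranges of the finite rank operators, the commutant
  is exactly the quaternions (\<open>quaternion_type_commuting_operators\<close>).

  The weights are nearly an invariant of similarity (\<open>similar_weights_bound\<close>). A similarity \<open>T\<close>
  carries left multiplication \<open>J\<close> by \<open>i\<close> to a map \<open>J'\<close> with square \<open>-1\<close> in the other commutant, that is,
  to left multiplication by an imaginary unit. Now \<open>J\<close> stretches \<open>e k 0\<close> by the
  factor \<open>b k\<close>. Suppose that no weight of the second algebra is comparable to \<open>b k\<close>. Split
  \<open>T (e k 0)\<close> into the part along those \<open>e n 0\<close> whose weight is much larger than \<open>b k\<close>, and the rest.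
  The first part is small, because \<open>J'\<close> stretches it a lot while \<open>J' (T (e k 0)) = T (J (e k 0))\<close> has norm of
  order \<open>b k\<close>. On the rest \<open>J'\<close> stretches far less than \<open>b k\<close>, so \<open>J\<close> does the same on
  its preimage under \<open>T\<close>; but that preimage is close to \<open>e k 0\<close>, a contradiction.

  Hence it suffices to find a continuum of weight sequences such that for any two of them the first
  has weights isolated from the weights of the second by arbitrarily large factors. The
  factorials have ratios tending to infinity; placing them only at the indices of a set attached to
  a real number, with the sets of different real numbers having infinite differences
  (\<open>infinite_levels_diff\<close>), gives such a family.
\<close>

section \<open>Finite-dimensional subspaces\<close>

text \<open>
  Both sides of the equation \<open>x = P x\<close>, with \<open>P\<close> the orthogonal projection onto the span, are continuous.
\<close>
lemma closed_span_of_finite: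
  fixes B :: "'a::real_inner set"
  assumes "finite B"
  shows "closed (span B)"
proof -
  obtain C where C: "finite C" "span C = span B" "pairwise orthogonal C"
    using basis_orthogonal[OF assms] by blast
  define P where "P = (\<lambda>x. \<Sum>c\<in>C. (c \<bullet> x / (c \<bullet> c)) *\<^sub>R c)"
  have P_in: "P x \<in> span C" for x
    unfolding P_def by (intro span_sum span_scale span_base)
  have "x = P x" if "x \<in> span C" for x
  proof -
    have "orthogonal (x - P x) c" if "c \<in> C" for c
    proof -
      have "P x \<bullet> c = (\<Sum>d\<in>C. if d = c then c \<bullet> x else 0)"
        unfolding P_def inner_sum_left using C(3) that
        by (intro sum.cong) (auto simp: pairwise_def orthogonal_def)
      then show ?thesis
        using C(1) that by (simp add: orthogonal_def inner_diff_left inner_diff_right inner_commute)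
    qed
    then have "orthogonal (x - P x) (x - P x)"
      using orthogonal_to_span[OF span_diff[OF that P_in]] by blast
    then show ?thesis by (simp add: orthogonal_self)
  qed
  then have "span C = {x. x = P x}"
    using P_in by (intro subset_antisym subsetI CollectI) (auto, metis)
  moreover have "closed {x. x = P x}"
    unfolding P_def divide_inverse by (intro closed_Collect_eq continuous_intros)
  ultimately show ?thesis using C(2) by simp
qed

lemma finite_dim_linear_image:
  assumes "linear f" "finite_dim V"
  shows "finite_dim (f ` V)"
proof -
  obtain B where "finite B" "span B = V" using assms(2) by (auto simp: finite_dim_def)
  then have "finite (f ` B)" "span (f ` B) = f ` V"
    using linear_span_image[OF assms(1), of B] by auto
  then show ?thesis unfolding finite_dim_def by blast
qed

section \<open>Orthonormal bases of separable Hilbert spaces\<close>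
definition orthonormal :: "'a::real_inner set \<Rightarrow> bool" where
  "orthonormal B \<longleftrightarrow> (\<forall>x\<in>B. \<forall>y\<in>B. x \<bullet> y = (if x = y then 1 else 0))"

lemma orthonormal_residual:
  assumes "orthonormal F" "finite F" "f \<in> F"
  shows "(x - (\<Sum>g\<in>F. (x \<bullet> g) *\<^sub>R g)) \<bullet> f = 0"
proof -
  have "(\<Sum>g\<in>F. (x \<bullet> g) *\<^sub>R g) \<bullet> f = (\<Sum>g\<in>F. if g = f then x \<bullet> g else 0)"
    unfolding inner_sum_left using assms(1,3)
    by (intro sum.cong) (auto simp: orthonormal_def)
  then show ?thesis using assms by (simp add: inner_diff_left)
qed

text \<open>
  A set that is maximal among the orthonormal ones, as given by Zorn's lemma, has no nonzero vector
  orthogonal to it: its normalisation could be added.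
\<close>

lemma ex_maximal_orthonormal:
  "\<exists>B :: 'a::real_inner set. orthonormal B \<and> (\<forall>x. (\<forall>y\<in>B. x \<bullet> y = 0) \<longrightarrow> x = 0)"
proof -
  have "\<exists>B\<in>Collect orthonormal. \<forall>X\<in>Collect (orthonormal :: 'a set \<Rightarrow> bool). B \<subseteq> X \<longrightarrow> X = B"
  proof (rule subset_Zorn')
    fix C :: "'a set set"
    assume chain: "subset.chain (Collect orthonormal) C"
    show "\<Union>C \<in> Collect orthonormal"
      unfolding orthonormal_def
    proof (intro CollectI ballI)
      fix x y assume "x \<in> \<Union>C" "y \<in> \<Union>C"
      then obtain U where "U \<in> C" "x \<in> U" "y \<in> U"
        using chain unfolding subset_chain_def by blast
      moreover have "orthonormal U" using chain \<open>U \<in> C\<close> by (auto simp: subset_chain_def)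
      ultimately show "x \<bullet> y = (if x = y then 1 else 0)"
        by (simp add: orthonormal_def)
    qed
  qed
  then obtain B :: "'a set" where B: "orthonormal B"
    and max: "\<And>X. orthonormal X \<Longrightarrow> B \<subseteq> X \<Longrightarrow> X = B" by auto
  have "x = 0" if orth: "\<forall>y\<in>B. x \<bullet> y = 0" for x
  proof (rule ccontr)
    assume "x \<noteq> 0"
    then have unit: "sgn x \<bullet> sgn x = 1"
      by (simp add: sgn_div_norm flip: power2_norm_eq_inner)
    have "sgn x \<bullet> y = 0" if "y \<in> B" for y using orth that by (simp add: sgn_div_norm)
    then have "orthonormal (insert (sgn x) B)"
      using B unit by (auto simp: orthonormal_def inner_commute)
    then have "sgn x \<in> B" using max by blast
    then show False using \<open>\<And>y. y \<in> B \<Longrightarrow> sgn x \<bullet> y = 0\<close> unit by force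
  qed
  with B show ?thesis by blast
qed

text \<open>
  Distinct orthonormal vectors are at distance \<open>sqrt 2\<close>, so they have distinct approximations
  within 1/2 in a countable dense set.
\<close>

lemma orthonormal_countable:
  fixes B :: "'a::real_inner set"
  assumes sep: "separable_space (euclidean :: 'a topology)" and B: "orthonormal B"
  shows "countable B"
proof -
  obtain D :: "'a set" where D: "countable D" and dense: "closure D = UNIV"
    using sep by (auto simp: separable_space_def)
  have "\<exists>d\<in>D. dist d x < 1/2" for x
  proof -
    have "x \<in> closure D" using dense by simp
    then show ?thesis unfolding closure_approachable by (metis half_gt_zero zero_less_one)
  qed
  then obtain d where d: "\<And>x. d x \<in> D" "\<And>x. dist (d x) x < 1/2" by metis
  have "inj_on d B"
  proof (rule inj_onI, rule ccontr)
    fix x y assume xy: "x \<in> B" "y \<in> B" "d x = d y" "x \<noteq> y"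
    have "dist x y < 1"
      using d(2)[of x] d(2)[of y] xy(3) by (metis dist_commute dist_triangle_half_l)
    moreover have "(norm (x - y))\<^sup>2 = 2"
      using xy B by (simp add: power2_norm_eq_inner inner_diff_left inner_diff_right orthonormal_def inner_commute)
    ultimately show False
      using abs_square_less_1[of "norm (x - y)"] by (simp add: dist_norm)
  qed
  moreover have "countable (d ` B)" using D d(1) by (meson countable_subset image_subsetI)
  ultimately show ?thesis by (rule countable_image_inj_on[rotated])
qed

text \<open>
  Bessel's inequality makes the partial sums Cauchy, and completeness of the space gives a limit
  with the same coefficients as \<open>x\<close>.
\<close>

lemma fourier_expansion:
  fixes f :: "nat \<Rightarrow> 'a::{real_inner,banach}"
  assumes orth: "\<And>m n. f m \<bullet> f n = (if m = n then 1 else 0)"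
    and total: "\<And>x. (\<And>n. x \<bullet> f n = 0) \<Longrightarrow> x = 0"
  shows "(\<lambda>n. (x \<bullet> f n) *\<^sub>R f n) sums x"
proof -
  have norm_sum: "(norm (\<Sum>i\<in>F. (x \<bullet> f i) *\<^sub>R f i))\<^sup>2 = (\<Sum>i\<in>F. (x \<bullet> f i)\<^sup>2)" if "finite F" for F
  proof -
    have "(norm (\<Sum>i\<in>F. (x \<bullet> f i) *\<^sub>R f i))\<^sup>2 = (\<Sum>i\<in>F. (norm ((x \<bullet> f i) *\<^sub>R f i))\<^sup>2)"
      using that by (intro norm_sum_Pythagorean) (auto simp: pairwise_def orthogonal_def orth)
    also have "\<dots> = (\<Sum>i\<in>F. (x \<bullet> f i)\<^sup>2)"
      by (simp add: norm_eq_sqrt_inner orth)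
    finally show ?thesis .
  qed
  have "(\<Sum>i\<in>F. (x \<bullet> f i)\<^sup>2) \<le> (norm x)\<^sup>2" if "finite F" for F
  proof -
    define p where "p = (\<Sum>i\<in>F. (x \<bullet> f i) *\<^sub>R f i)"
    have "x \<bullet> p = (\<Sum>i\<in>F. (x \<bullet> f i)\<^sup>2)"
      by (simp add: p_def inner_sum_right power2_eq_square)
    moreover have "p \<bullet> p = (\<Sum>i\<in>F. (x \<bullet> f i)\<^sup>2)"
      using norm_sum[OF that] by (simp add: p_def power2_norm_eq_inner)
    moreover have "0 \<le> (x - p) \<bullet> (x - p)" by simp
    ultimately show ?thesis
      by (simp add: inner_diff_left inner_diff_right inner_commute power2_norm_eq_inner)
  qed
  then have "summable (\<lambda>i. (x \<bullet> f i)\<^sup>2)"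
    by (intro bounded_imp_summable[of _ "(norm x)\<^sup>2"]) auto
  have "summable (\<lambda>n. (x \<bullet> f n) *\<^sub>R f n)"
    unfolding summable_Cauchy
  proof (intro allI impI)
    fix \<epsilon> :: real assume "\<epsilon> > 0"
    then obtain N where N: "\<And>m n. m \<ge> N \<Longrightarrow> norm (\<Sum>i=m..<n. (x \<bullet> f i)\<^sup>2) < \<epsilon>\<^sup>2"
      using \<open>summable (\<lambda>i. (x \<bullet> f i)\<^sup>2)\<close> unfolding summable_Cauchy by (meson zero_less_power)
    have "norm (\<Sum>i=m..<n. (x \<bullet> f i) *\<^sub>R f i) < \<epsilon>" if "m \<ge> N" for m n
    proof (rule power2_less_imp_less)
      show "(norm (\<Sum>i=m..<n. (x \<bullet> f i) *\<^sub>R f i))\<^sup>2 < \<epsilon>\<^sup>2"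
        using N[OF that, of n] by (simp add: norm_sum)
    qed (use \<open>\<epsilon> > 0\<close> in simp)
    then show "\<exists>N. \<forall>m\<ge>N. \<forall>n. norm (\<Sum>i=m..<n. (x \<bullet> f i) *\<^sub>R f i) < \<epsilon>" by blast
  qed
  then obtain y where y: "(\<lambda>n. (x \<bullet> f n) *\<^sub>R f n) sums y" by (auto simp: summable_def)
  have "y \<bullet> f k = x \<bullet> f k" for k
  proof -
    have "(\<lambda>n. ((x \<bullet> f n) *\<^sub>R f n) \<bullet> f k) sums (y \<bullet> f k)"
      by (rule bounded_linear.sums[OF bounded_linear_inner_left y])
    moreover have "(\<lambda>n. ((x \<bullet> f n) *\<^sub>R f n) \<bullet> f k) = (\<lambda>n. if n = k then x \<bullet> f n else 0)"
      by (auto simp: orth)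
    ultimately show ?thesis using sums_single[of k "\<lambda>n. x \<bullet> f n"] sums_unique2 by fastforce
  qed
  then have "x - y = 0" by (intro total) (simp add: inner_diff_left)
  with y show ?thesis by simp
qed

lemma ex_orthonormal_basis:
  assumes inf: "\<not> (\<exists>B. finite B \<and> span B = (UNIV :: 'h::{real_inner, banach} set))"
    and sep: "separable_space (euclidean :: 'h topology)"
  shows "\<exists>f :: nat \<Rightarrow> 'h. (\<forall>m n. f m \<bullet> f n = (if m = n then 1 else 0)) \<and>
           (\<forall>x. (\<lambda>n. (x \<bullet> f n) *\<^sub>R f n) sums x)"
proof -
  obtain B :: "'h set" where B: "orthonormal B" and total: "\<And>x. (\<forall>y\<in>B. x \<bullet> y = 0) \<Longrightarrow> x = 0"
    using ex_maximal_orthonormal by blast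
  have "infinite B"
  proof
    assume "finite B"
    have "x \<in> span B" for x
    proof -
      have "x - (\<Sum>g\<in>B. (x \<bullet> g) *\<^sub>R g) = 0"
        by (intro total ballI orthonormal_residual B \<open>finite B\<close>)
      then have "x = (\<Sum>g\<in>B. (x \<bullet> g) *\<^sub>R g)" by simp
      also have "\<dots> \<in> span B" by (intro span_sum span_scale span_base)
      finally show ?thesis .
    qed
    then show False using inf \<open>finite B\<close> by blast
  qed
  then have bij: "bij_betw (from_nat_into B) UNIV B"
    using orthonormal_countable[OF sep B] bij_betw_from_nat_into by blast
  define f where "f = from_nat_into B"
  have "f m \<bullet> f n = (if m = n then 1 else 0)" for m n
  proof -
    have "f m \<in> B" "f n \<in> B" "f m = f n \<longleftrightarrow> m = n"
      using bij by (auto simp: f_def bij_betw_def inj_eq)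
    then show ?thesis using B by (simp add: orthonormal_def)
  qed
  moreover have "x = 0" if "\<And>n. x \<bullet> f n = 0" for x
  proof (rule total, rule ballI)
    fix y assume "y \<in> B"
    then obtain n where "y = f n" using bij by (auto simp: f_def bij_betw_def)
    then show "x \<bullet> y = 0" using that by simp
  qed
  ultimately show ?thesis using fourier_expansion[of f] by blast
qed

section \<open>Quaternions\<close>
lemmas quaternion_arith = zero_quaternion_def one_quaternion_def plus_quaternion_def
  uminus_quaternion_def minus_quaternion_def scaleR_quaternion_def times_quaternion_def

lemma quaternion_right_inverse:
  assumes "q \<noteq> (0 :: quaternion)"
  obtains r where "q * r = 1"
proof
  define N where "N = (qre q)\<^sup>2 + (qi q)\<^sup>2 + (qj q)\<^sup>2 + (qk q)\<^sup>2"
  have "N \<noteq> 0"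
  proof
    assume "N = 0"
    then have "qre q = 0 \<and> qi q = 0 \<and> qj q = 0 \<and> qk q = 0"
      unfolding N_def by (simp add: add_nonneg_eq_0_iff)
    with assms show False by (cases q) (simp add: zero_quaternion_def)
  qed
  have "q * Quat (qre q / N) (- qi q / N) (- qj q / N) (- qk q / N) =
    Quat (((qre q)\<^sup>2 + (qi q)\<^sup>2 + (qj q)\<^sup>2 + (qk q)\<^sup>2) / N) 0 0 0"
    unfolding times_quaternion_def
    by (simp add: power2_eq_square add_divide_distrib mult.commute)
  then show "q * Quat (qre q / N) (- qi q / N) (- qj q / N) (- qk q / N) = 1"
    using \<open>N \<noteq> 0\<close> by (simp add: one_quaternion_def flip: N_def)
qed

definition imaginary_unit :: "quaternion \<Rightarrow> bool" where
  "imaginary_unit p \<longleftrightarrow> qre p = 0 \<and> (qi p)\<^sup>2 + (qj p)\<^sup>2 + (qk p)\<^sup>2 = 1"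

text \<open>
  The real part of the equation excludes real solutions, and then its imaginary part forces
  \<open>qre p = 0\<close>.
\<close>

lemma imaginary_unitI:
  assumes "p * p = (- 1 :: quaternion)"
  shows "imaginary_unit p"
proof -
  have re: "(qre p)\<^sup>2 - ((qi p)\<^sup>2 + (qj p)\<^sup>2 + (qk p)\<^sup>2) = -1"
    and "qre p * qi p = 0" "qre p * qj p = 0" "qre p * qk p = 0"
    using assms by (auto simp: quaternion_arith power2_eq_square)
  then have "qre p = 0 \<or> (qi p = 0 \<and> qj p = 0 \<and> qk p = 0)" by auto
  then have "qre p = 0"
  proof
    assume "qi p = 0 \<and> qj p = 0 \<and> qk p = 0"
    with re have "(qre p)\<^sup>2 = -1" by simp
    then show ?thesis by (smt (verit) zero_le_power2)
  qed
  with re show ?thesis by (simp add: imaginary_unit_def)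
qed

section \<open>The algebra of operators commuting with a weighted quaternion structure\<close>
locale quaternion_frame =
  fixes e :: "nat \<Rightarrow> nat \<Rightarrow> 'h::{real_inner,banach}" and b :: "nat \<Rightarrow> real"
  assumes orth: "\<And>m n k l. k < 4 \<Longrightarrow> l < 4 \<Longrightarrow> e m k \<bullet> e n l = (if m = n \<and> k = l then 1 else 0)"
    and expansion: "\<And>x. (\<lambda>N. \<Sum>n<N. \<Sum>k<4. (x \<bullet> e n k) *\<^sub>R e n k) \<longlonglongrightarrow> x"
    and weight_ge_1: "\<And>n. 1 \<le> b n"
begin

text \<open>
  The coordinates identify the block \<open>n\<close> with the quaternions so that the structure under study
  becomes left multiplication; \<open>embed n\<close> is the inverse identification.
\<close>

definition coord :: "nat \<Rightarrow> 'h \<Rightarrow> quaternion" where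
  "coord n x = Quat (x \<bullet> e n 0) (x \<bullet> e n 1 / b n) (x \<bullet> e n 2 / b n) (x \<bullet> e n 3 / b n)"

definition embed :: "nat \<Rightarrow> quaternion \<Rightarrow> 'h" where
  "embed n p = qre p *\<^sub>R e n 0 + b n *\<^sub>R (qi p *\<^sub>R e n 1 + qj p *\<^sub>R e n 2 + qk p *\<^sub>R e n 3)"

lemma weight_pos [simp]: "0 < b n" "b n \<noteq> 0"
  using weight_ge_1[of n] by linarith+

lemma linear_coord: "linear (coord n)"
  by (rule linearI) (simp_all add: coord_def quaternion_arith inner_add_left add_divide_distrib)

lemma linear_embed: "linear (embed n)"
  by (rule linearI) (simp_all add: embed_def quaternion_arith algebra_simps)

lemmas coord_simps = linear_add[OF linear_coord] linear_scale[OF linear_coord]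
  linear_diff[OF linear_coord] linear_0[OF linear_coord] linear_sum[OF linear_coord]
lemmas embed_simps = linear_add[OF linear_embed] linear_scale[OF linear_embed]
  linear_diff[OF linear_embed] linear_0[OF linear_embed] linear_sum[OF linear_embed]

lemma coord_embed: "coord n (embed m p) = (if n = m then p else 0)"
  by (auto simp: coord_def embed_def zero_quaternion_def inner_add_left orth)

lemma embed_eq_iff: "embed n p = embed n q \<longleftrightarrow> p = q"
  by (metis coord_embed)

lemma embed_coord: "embed n (coord n x) = (\<Sum>k<4. (x \<bullet> e n k) *\<^sub>R e n k)"
  by (simp add: embed_def coord_def algebra_simps eval_nat_numeral)

lemma block_expansion: "(\<lambda>N. \<Sum>n<N. embed n (coord n x)) \<longlonglongrightarrow> x"
  using expansion[of x] by (simp add: embed_coord)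

lemma coord_eqI: "(\<And>n. coord n x = coord n y) \<Longrightarrow> x = y"
  using block_expansion[of x] block_expansion[of y] LIMSEQ_unique by fastforce

text \<open>
  A map between blocks that is linear in coordinates is a finite sum of rank one operators; this gives its
  boundedness and, below, its compactness.
\<close>

lemma embed_linear_coord:
  assumes "linear L"
  shows "embed n (L (coord m x)) = (x \<bullet> e m 0) *\<^sub>R embed n (L (Quat 1 0 0 0))
    + (x \<bullet> e m 1 / b m) *\<^sub>R embed n (L (Quat 0 1 0 0))
    + (x \<bullet> e m 2 / b m) *\<^sub>R embed n (L (Quat 0 0 1 0))
    + (x \<bullet> e m 3 / b m) *\<^sub>R embed n (L (Quat 0 0 0 1))"
proof -
  have "coord m x = (x \<bullet> e m 0) *\<^sub>R Quat 1 0 0 0 + (x \<bullet> e m 1 / b m) *\<^sub>R Quat 0 1 0 0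
    + (x \<bullet> e m 2 / b m) *\<^sub>R Quat 0 0 1 0 + (x \<bullet> e m 3 / b m) *\<^sub>R Quat 0 0 0 1"
    by (simp add: coord_def quaternion_arith)
  then show ?thesis
    by (simp only: linear_add[OF assms] linear_scale[OF assms] embed_simps)
qed

lemma bounded_linear_block:
  assumes "linear L"
  shows "bounded_linear (\<lambda>x. embed n (L (coord m x)))"
  unfolding embed_linear_coord[OF assms] divide_inverse
  by (intro bounded_linear_add bounded_linear_scaleR_const bounded_linear_mult_const bounded_linear_inner_left)

lemma linear_mult_right: "linear (\<lambda>p::quaternion. p * r)"
  by (rule linearI) (simp_all add: algebra_simps)

lemma linear_mult_left: "linear (\<lambda>p::quaternion. r * p)"
  by (rule linearI) (simp_all add: algebra_simps)

text \<open>
  The condition says that in coordinates every matrix entry is a right multiplication, which is how an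
  operator commutes with left multiplication. It is imposed on vectors in a single block only,
  because left multiplication need not be defined on the whole space.
\<close>

definition commuting_operators :: "('h \<Rightarrow>\<^sub>L 'h) set" where
  "commuting_operators = {T. \<forall>n m p. coord n (blinfun_apply T (embed m p)) = p * coord n (blinfun_apply T (embed m 1))}"

definition entry :: "nat \<Rightarrow> nat \<Rightarrow> quaternion \<Rightarrow> 'h \<Rightarrow>\<^sub>L 'h" where
  "entry n m r = Blinfun (\<lambda>x. embed n (coord m x * r))"

lemma entry_apply: "entry n m r x = embed n (coord m x * r)"
  unfolding entry_def by (rule bounded_linear_Blinfun_apply[OF bounded_linear_block[OF linear_mult_right], THEN fun_cong])

lemma entry_in_commuting_operators: "entry n m r \<in> commuting_operators"
  by (auto simp: commuting_operators_def entry_apply coord_embed mult.assoc embed_simps linear_0[OF linear_coord])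

lemma commuting_operators_apply_finite:
  assumes "T \<in> commuting_operators" "finite I"
  shows "coord n (T (\<Sum>m\<in>I. embed m (q * f m))) = q * coord n (T (\<Sum>m\<in>I. embed m (f m)))"
proof -
  have "coord n (blinfun_apply T (embed m (q * f m))) = q * coord n (blinfun_apply T (embed m (f m)))" for m
  proof -
    have *: "coord n (T (embed m p)) = p * coord n (T (embed m 1))" for p
      using assms(1) unfolding commuting_operators_def by blast
    show ?thesis by (simp only: *[of "q * f m"] *[of "f m"] mult.assoc)
  qed
  then show ?thesis
    by (simp add: blinfun.sum_right coord_simps sum_distrib_left)
qed

text \<open>
  If \<open>y\<close> is a left multiple of \<open>x\<close> in every block, then so it is for finite truncations, and
  the relation between \<open>T y\<close> and \<open>T x\<close> follows in the limit. Thus the operators commute with the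
  left multiplications on their full domain.
\<close>

lemma commuting_operators_intertwines:
  assumes T: "T \<in> commuting_operators" and y: "\<And>k. coord k y = q * coord k x"
  shows "coord n (T y) = q * coord n (T x)"
proof -
  define P where "P N v = (\<Sum>k<N. embed k (coord k v))" for N v
  have lim: "(\<lambda>N. T (P N v)) \<longlonglongrightarrow> T v" for v
    unfolding P_def by (intro blinfun.tendsto tendsto_const block_expansion)
  have eq: "coord n (T (P N y)) = q * coord n (T (P N x))" for N
    using commuting_operators_apply_finite[OF T, of "{..<N}"] by (simp add: P_def y)
  have bl: "bounded_linear (\<lambda>x. embed n (r * coord n x))" for r
    by (intro bounded_linear_block linear_mult_left)
  have "(\<lambda>N. embed n (1 * coord n (T (P N y)))) \<longlonglongrightarrow> embed n (1 * coord n (T y))"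
    by (rule bounded_linear.tendsto[OF bl lim])
  moreover have "(\<lambda>N. embed n (q * coord n (T (P N x)))) \<longlonglongrightarrow> embed n (q * coord n (T x))"
    by (rule bounded_linear.tendsto[OF bl lim])
  ultimately have "embed n (coord n (T y)) = embed n (q * coord n (T x))"
    using LIMSEQ_unique by (simp add: eq)
  then show ?thesis by (simp only: embed_eq_iff)
qed

lemma commuting_operators_compose:
  assumes S: "S \<in> commuting_operators" and T: "T \<in> commuting_operators"
  shows "S o\<^sub>L T \<in> commuting_operators"
proof -
  have "coord n (S (T (embed m p))) = p * coord n (S (T (embed m 1)))" for n m p
  proof (rule commuting_operators_intertwines[OF S])
    show "coord k (T (embed m p)) = p * coord k (T (embed m 1))" for k
      using T unfolding commuting_operators_def by blast
  qed
  then show ?thesis unfolding commuting_operators_def mem_Collect_eq blinfun_apply_blinfun_compose by blast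
qed

lemma subspace_commuting_operators: "subspace commuting_operators"
proof (rule subspaceI)
  show "0 \<in> commuting_operators" by (simp add: commuting_operators_def coord_simps)
  show "S + T \<in> commuting_operators" if "S \<in> commuting_operators" "T \<in> commuting_operators" for S T
    using that unfolding commuting_operators_def mem_Collect_eq blinfun.add_left coord_simps distrib_left by metis
  show "r *\<^sub>R T \<in> commuting_operators" if "T \<in> commuting_operators" for r T
    using that unfolding commuting_operators_def mem_Collect_eq blinfun.scaleR_left coord_simps mult_scaleR_right by metis
qed

lemma closedin_commuting_operators: "closedin strong_operator_topology commuting_operators"
proof -
  have "closedin strong_operator_topology
      {T \<in> topspace strong_operator_topology. embed n (1 * coord n (blinfun_apply T (embed m p))) = embed n (p * coord n (blinfun_apply T (embed m 1)))}"
    for n m p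
  proof (rule closedin_continuous_maps_eq)
    have *: "continuous_map strong_operator_topology euclidean (\<lambda>T. embed n (r * coord n (blinfun_apply T x)))" for r x
    proof -
      have "continuous_map euclidean euclidean (\<lambda>x. embed n (r * coord n x))"
        using linear_continuous_on[OF bounded_linear_block[OF linear_mult_left]] by simp
      from continuous_map_compose[OF strong_operator_topology_continuous_evaluation this]
      show ?thesis by (simp add: comp_def)
    qed
    show "continuous_map strong_operator_topology euclidean (\<lambda>T. embed n (1 * coord n (blinfun_apply T (embed m p))))"
      "continuous_map strong_operator_topology euclidean (\<lambda>T. embed n (p * coord n (blinfun_apply T (embed m 1))))"
      by (rule *)+
  qed simp
  then have "closedin strong_operator_topology (\<Inter>(n, m, p)\<in>UNIV.
      {T. embed n (1 * coord n (blinfun_apply T (embed m p))) = embed n (p * coord n (blinfun_apply T (embed m 1)))})"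
    by (intro closedin_Inter) (auto simp: strong_operator_topology_topspace)
  also have "(\<Inter>(n, m, p)\<in>UNIV.
      {T. embed n (1 * coord n (blinfun_apply T (embed m p))) = embed n (p * coord n (blinfun_apply T (embed m 1)))}) = commuting_operators"
    unfolding commuting_operators_def embed_eq_iff mult_1_left by blast
  finally show ?thesis .
qed

text \<open>
  From a vector with a nonzero coordinate the matrix entries reach every vector of every block, since
  the coordinate is an invertible quaternion; these vectors span a dense subspace.
\<close>

lemma transitive_commuting_operators: "transitive_algebra commuting_operators"
  unfolding transitive_algebra_def
proof (intro allI impI, elim conjE)
  fix M :: "'h set" assume M: "subspace M" "closed M" and inv: "\<forall>T\<in>commuting_operators. blinfun_apply T ` M \<subseteq> M"
  show "M = {0} \<or> M = UNIV"
  proof (cases "M = {0}")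
    case False
    then obtain x where x: "x \<in> M" "x \<noteq> 0" using subspace_0[OF M(1)] by blast
    then obtain m where "coord m x \<noteq> 0"
      using coord_eqI[of x 0] by (auto simp: coord_simps)
    then obtain r where r: "coord m x * r = 1" by (rule quaternion_right_inverse)
    have embed_M: "embed n p \<in> M" for n p
    proof -
      have "entry n m (r * p) x \<in> M" using inv entry_in_commuting_operators x(1) by blast
      then show ?thesis by (simp add: entry_apply r flip: mult.assoc)
    qed
    have "y \<in> M" for y
      by (rule closed_sequentially[OF M(2) _ block_expansion[of y]])
         (intro subspace_sum[OF M(1)] embed_M)
    then show ?thesis by blast
  qed simp
qed

lemma embed_decompose:
  "embed n p = qre p *\<^sub>R e n 0 + (b n * qi p) *\<^sub>R e n 1 + (b n * qj p) *\<^sub>R e n 2 + (b n * qk p) *\<^sub>R e n 3"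
  by (simp add: embed_def algebra_simps)

lemma range_embed: "range (embed n) = span {e n 0, e n 1, e n 2, e n 3}"
proof
  show "range (embed n) \<subseteq> span {e n 0, e n 1, e n 2, e n 3}"
    unfolding embed_decompose by (auto intro!: span_add span_scale intro: span_base)
  have "e n 0 = embed n (Quat 1 0 0 0)" "e n 1 = embed n (Quat 0 (1 / b n) 0 0)"
    "e n 2 = embed n (Quat 0 0 (1 / b n) 0)" "e n 3 = embed n (Quat 0 0 0 (1 / b n))"
    by (simp_all add: embed_def)
  then show "span {e n 0, e n 1, e n 2, e n 3} \<subseteq> range (embed n)"
    using linear_subspace_image[OF linear_embed subspace_UNIV] by (intro span_minimal) auto
qed

text \<open>
  The image of the unit ball lies in a sum of four segments.
\<close>

lemma compact_operator_entry: "compact_operator (entry n m r)"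
proof -
  define K where "K y = (\<lambda>t. t *\<^sub>R y) ` {-1..1::real}" for y :: 'h
  define v where "v k = embed n ((if k = 0 then Quat 1 0 0 0 else if k = 1 then Quat 0 1 0 0
    else if k = (2::nat) then Quat 0 0 1 0 else Quat 0 0 0 1) * r)" for k
  have K_mem: "t *\<^sub>R y \<in> K y" if "\<bar>t\<bar> \<le> 1" for t y
    unfolding K_def by (rule image_eqI[of _ _ t]) (use that in auto)
  have cK: "compact (K y)" for y
    unfolding K_def by (intro compact_continuous_image continuous_intros compact_Icc)
  define L where "L = {((x + y) + z) + w |x y z w. x \<in> K (v 0) \<and> y \<in> K (v 1) \<and> z \<in> K (v 2) \<and> w \<in> K (v 3)}"
  have L: "L = {x + w |x w. x \<in> {x + z |x z. x \<in> {x + y |x y. x \<in> K (v 0) \<and> y \<in> K (v 1)} \<and> z \<in> K (v 2)} \<and> w \<in> K (v 3)}"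
    unfolding L_def by blast
  have cL: "compact L" unfolding L by (intro compact_sums cK)
  have "entry n m r x \<in> L" if "x \<in> cball 0 1" for x
  proof -
    have "\<bar>x \<bullet> e m k\<bar> \<le> 1" if "k < 4" for k
    proof -
      have "norm (e m k) = 1" using that by (simp add: norm_eq_sqrt_inner orth)
      then show ?thesis
        using Cauchy_Schwarz_ineq2[of x "e m k"] \<open>x \<in> cball 0 1\<close> by auto
    qed
    then have c: "\<bar>x \<bullet> e m k\<bar> \<le> 1" "\<bar>x \<bullet> e m k / b m\<bar> \<le> 1" if "k < 4" for k
      using that weight_ge_1[of m] by (force simp: divide_le_eq)+
    have "(x \<bullet> e m 0) *\<^sub>R v 0 \<in> K (v 0)" "(x \<bullet> e m 1 / b m) *\<^sub>R v 1 \<in> K (v 1)"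
      "(x \<bullet> e m 2 / b m) *\<^sub>R v 2 \<in> K (v 2)" "(x \<bullet> e m 3 / b m) *\<^sub>R v 3 \<in> K (v 3)"
      by (intro K_mem c; simp)+
    then show ?thesis
      unfolding entry_apply embed_linear_coord[OF linear_mult_right] L_def v_def by auto
  qed
  then have "closure (entry n m r ` cball 0 1) \<subseteq> L"
    using compact_imp_closed[OF cL] by (intro closure_minimal) auto
  then show ?thesis
    unfolding compact_operator_def using compact_Int_closed[OF cL closed_closure] by (metis Int_absorb1)
qed

lemma lomonosov_commuting_operators: "lomonosov_algebra commuting_operators"
proof -
  have "entry 0 0 1 \<noteq> 0"
  proof
    assume "entry 0 0 1 = 0"
    then have "coord 0 (entry 0 0 1 (embed 0 1)) = 0" by (simp add: coord_simps)
    then show False by (simp add: entry_apply coord_embed)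
  qed
  then show ?thesis
    unfolding lomonosov_algebra_def operator_subalgebra_def
    using subspace_commuting_operators commuting_operators_compose closedin_commuting_operators transitive_commuting_operators
      entry_in_commuting_operators compact_operator_entry by blast
qed

section \<open>The commutant on the span of the finite rank ranges\<close>
lemma finite_rank_entry: "entry n m r \<in> finite_rank_part commuting_operators"
proof -
  have "range (entry n m r) = entry n m r ` range (embed m)"
  proof
    show "range (entry n m r) \<subseteq> entry n m r ` range (embed m)"
    proof (rule image_subsetI)
      fix x
      have "entry n m r x = entry n m r (embed m (coord m x))"
        by (simp add: entry_apply coord_embed)
      then show "entry n m r x \<in> entry n m r ` range (embed m)" by blast
    qed
  qed blast
  moreover have "finite_dim (range (embed m))"
    unfolding range_embed finite_dim_def
    by (intro exI[of _ "{e m 0, e m 1, e m 2, e m 3}"]) simp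
  ultimately have "finite_dim (range (entry n m r))"
    by (simp add: finite_dim_linear_image blinfun.bounded_linear_right bounded_linear.linear)
  then show ?thesis by (simp add: finite_rank_part_def entry_in_commuting_operators)
qed

abbreviation XF where "XF \<equiv> finite_rank_space commuting_operators"

lemma subspace_XF: "subspace XF" unfolding finite_rank_space_def by (rule subspace_span)

lemma apply_in_XF: "T \<in> finite_rank_part commuting_operators \<Longrightarrow> T x \<in> XF"
  unfolding finite_rank_space_def by (rule span_base) blast

lemma embed_in_XF: "embed n p \<in> XF"
  using apply_in_XF[OF finite_rank_entry[of n n 1], of "embed n p"] by (simp add: entry_apply coord_embed)

text \<open>
  The image under \<open>T\<close> of the dense subspace of vectors with finitely many nonzero blocks is dense in
  the range of \<open>T\<close>, and it is closed because it is finite-dimensional. This is what makes left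
  multiplication available on ranges of finite rank operators, as it is defined on the dense
  subspace.
\<close>

lemma finite_rank_attained:
  assumes "T \<in> finite_rank_part commuting_operators"
  shows "\<exists>y\<in>span (\<Union>m. range (embed m)). T x = T y"
proof -
  define F where "F = span (\<Union>m. range (embed m))"
  have lin: "linear (blinfun_apply T)" by (simp add: blinfun.bounded_linear_right bounded_linear.linear)
  obtain B where B: "finite B" "span B = range T"
    using assms by (auto simp: finite_rank_part_def finite_dim_def)
  have "subspace (T ` F)" unfolding F_def by (intro linear_subspace_image lin subspace_span)
  moreover obtain C where C: "C \<subseteq> T ` F" "independent C" "T ` F \<subseteq> span C"
    using maximal_independent_subset by blast
  ultimately have "span C = T ` F" by (metis span_subspace)
  moreover have "finite C"
    using independent_span_bound[OF B(1) C(2)] C(1) B(2) by blast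
  ultimately have "closed (T ` F)" by (metis closed_span_of_finite)
  moreover have "T (\<Sum>n<N. embed n (coord n x)) \<in> T ` F" for N
    unfolding F_def by (intro imageI span_sum span_base) blast
  moreover have "(\<lambda>N. T (\<Sum>n<N. embed n (coord n x))) \<longlonglongrightarrow> T x"
    by (intro blinfun.tendsto tendsto_const block_expansion)
  ultimately have "T x \<in> T ` F" by (rule closed_sequentially)
  then show ?thesis unfolding F_def by blast
qed

lemma left_multiple_finite_support:
  assumes "y \<in> span (\<Union>m. range (embed m))"
  shows "\<exists>z. \<forall>n. coord n z = q * coord n y"
  using assms
proof (induction rule: span_induct_alt)
  case base
  show ?case by (rule exI[of _ 0]) (simp add: coord_simps)
next
  case (step c x y)
  then obtain m p where x: "x = embed m p" by blast
  from step obtain z where z: "\<And>n. coord n z = q * coord n y" by blast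
  show ?case
    by (rule exI[of _ "c *\<^sub>R embed m (q * p) + z"])
       (auto simp: x coord_simps z coord_embed algebra_simps)
qed

lemma left_multiple_exists:
  assumes "x \<in> XF"
  shows "\<exists>z\<in>XF. \<forall>n. coord n z = q * coord n x"
  using assms unfolding finite_rank_space_def
proof (induction rule: span_induct_alt)
  case base
  show ?case by (rule bexI[of _ 0]) (simp_all add: coord_simps span_zero)
next
  case (step c x y)
  then obtain T :: "'h \<Rightarrow>\<^sub>L 'h" and u where x: "x = T u" and T: "T \<in> finite_rank_part commuting_operators" by blast
  obtain v where v: "v \<in> span (\<Union>m. range (embed m))" "T u = T v"
    using finite_rank_attained[OF T] by blast
  obtain w where w: "\<And>n. coord n w = q * coord n v"
    using left_multiple_finite_support[OF v(1)] by blast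
  have Tw: "coord n (T w) = q * coord n x" for n
    using commuting_operators_intertwines[OF _ w] T v(2) x by (simp add: finite_rank_part_def)
  from step obtain z where z: "z \<in> XF" "\<And>n. coord n z = q * coord n y"
    unfolding finite_rank_space_def by blast
  have "c *\<^sub>R T w + z \<in> XF"
    by (intro subspace_add subspace_scale subspace_XF apply_in_XF[OF T] z)
  moreover have "coord n (c *\<^sub>R T w + z) = q * coord n (c *\<^sub>R x + y)" for n
    by (simp add: coord_simps Tw z distrib_left)
  ultimately show ?case unfolding finite_rank_space_def by blast
qed

text \<open>
  The coordinates determine a vector, so at most one vector satisfies the condition; outside the
  subspace the value is the one prescribed for members of \<^const>\<open>finite_rank_commutant\<close>.
\<close>

definition left :: "quaternion \<Rightarrow> 'h \<Rightarrow> 'h" where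
  "left q = (\<lambda>x\<in>XF. SOME z. z \<in> XF \<and> (\<forall>n. coord n z = q * coord n x))"

lemma
  assumes "x \<in> XF"
  shows left_in_XF: "left q x \<in> XF" and coord_left: "coord n (left q x) = q * coord n x"
proof -
  have "\<exists>z. z \<in> XF \<and> (\<forall>n. coord n z = q * coord n x)"
    using left_multiple_exists[OF assms, of q] by blast
  from someI_ex[OF this] show "left q x \<in> XF" "coord n (left q x) = q * coord n x"
    using assms by (simp_all add: left_def)
qed

lemma left_eqI: "x \<in> XF \<Longrightarrow> (\<And>n. coord n z = q * coord n x) \<Longrightarrow> z = left q x"
  by (rule coord_eqI) (simp add: coord_left)

lemma left_in_commutant: "left q \<in> finite_rank_commutant commuting_operators"
proof -
  have "left q \<in> XF \<rightarrow>\<^sub>E XF"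
    by (intro PiE_I) (simp_all add: left_in_XF, simp add: left_def)
  moreover have "left q (x + y) = left q x + left q y" if "x \<in> XF" "y \<in> XF" for x y
    using that by (intro left_eqI[symmetric] subspace_add subspace_XF) (simp_all add: coord_simps coord_left distrib_left)
  moreover have "left q (r *\<^sub>R x) = r *\<^sub>R left q x" if "x \<in> XF" for x r
    using that by (intro left_eqI[symmetric] subspace_scale subspace_XF) (simp_all add: coord_simps coord_left)
  moreover have "left q (T x) = T (left q x)" if "T \<in> finite_rank_part commuting_operators" "x \<in> XF" for T x
    using that by (intro left_eqI[symmetric] apply_in_XF commuting_operators_intertwines)
      (simp_all add: finite_rank_part_def coord_left)
  ultimately show ?thesis by (simp add: finite_rank_commutant_def)
qed

text \<open>
  The matrix entries transport the value of \<open>D\<close> at \<open>embed 0 1\<close> first to the whole block 0 and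
  then, by mapping block \<open>n\<close> to block 0, to all coordinates of \<open>D x\<close>.
\<close>

lemma commutant_is_left:
  assumes "D \<in> finite_rank_commutant commuting_operators"
  shows "\<exists>q. D = left q"
proof -
  have comm: "D (T x) = T (D x)" if "T \<in> finite_rank_part commuting_operators" "x \<in> XF" for T x
    using assms that by (auto simp: finite_rank_commutant_def)
  define q where "q = coord 0 (D (embed 0 1))"
  have D0: "D (embed 0 p) = embed 0 (q * p)" for p
    using comm[OF finite_rank_entry embed_in_XF, of 0 0 p 0 1]
    by (simp add: entry_apply coord_embed q_def)
  have "coord n (D x) = q * coord n x" if "x \<in> XF" for n x
  proof -
    have "embed 0 (coord n (D x)) = entry 0 n 1 (D x)" by (simp add: entry_apply)
    also have "\<dots> = D (entry 0 n 1 x)" by (rule comm[symmetric, OF finite_rank_entry that])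
    also have "\<dots> = embed 0 (q * coord n x)" by (simp add: entry_apply D0)
    finally show ?thesis by (simp only: embed_eq_iff)
  qed
  then have "D x = left q x" if "x \<in> XF" for x using that by (intro left_eqI)
  moreover have "D x = left q x" if "x \<notin> XF" for x
  proof -
    have "D \<in> XF \<rightarrow>\<^sub>E XF" using assms unfolding finite_rank_commutant_def by blast
    then have "D x = undefined" using that by (rule PiE_arb)
    then show ?thesis using that by (simp add: left_def)
  qed
  ultimately show ?thesis by blast
qed

lemma inj_left: "inj left"
proof (rule injI)
  fix p q assume "left p = left q"
  then have "coord 0 (left p (embed 0 1)) = coord 0 (left q (embed 0 1))" by simp
  then show "p = q" by (simp add: coord_left embed_in_XF coord_embed)
qed

lemma left_extensionality:
  assumes "\<And>n x. x \<in> XF \<Longrightarrow> coord n (g x) = q * coord n x"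
  shows "left q = (\<lambda>x\<in>XF. g x)"
proof
  fix x
  show "left q x = (\<lambda>x\<in>XF. g x) x"
  proof (cases "x \<in> XF")
    case True
    then show ?thesis using left_eqI[of x "g x" q] assms by simp
  qed (simp add: left_def)
qed

lemma quaternion_type_commuting_operators: "quaternion_type commuting_operators"
  unfolding quaternion_type_def
proof (intro exI conjI allI)
  show "bij_betw left UNIV (finite_rank_commutant commuting_operators)"
    unfolding bij_betw_def using inj_left left_in_commutant commutant_is_left by blast
  show "left (p + q) = (\<lambda>x\<in>XF. left p x + left q x)" for p q
    by (rule left_extensionality) (simp add: coord_simps coord_left distrib_right)
  show "left (r *\<^sub>R p) = (\<lambda>x\<in>XF. r *\<^sub>R left p x)" for r p
    by (rule left_extensionality) (simp add: coord_simps coord_left)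
  show "left (p * q) = compose XF (left p) (left q)" for p q
    unfolding compose_def
    by (rule left_extensionality) (simp add: coord_left left_in_XF mult.assoc)
qed

section \<open>How far left multiplication by an imaginary unit stretches\<close>
lemma norm_embed: "(norm (embed n p))\<^sup>2 = (qre p)\<^sup>2 + (b n)\<^sup>2 * ((qi p)\<^sup>2 + (qj p)\<^sup>2 + (qk p)\<^sup>2)"
  unfolding power2_norm_eq_inner embed_def
  by (simp add: inner_add_left inner_add_right orth power2_eq_square algebra_simps)

lemma norm_sum_embed:
  assumes "finite I"
  shows "(norm (\<Sum>m\<in>I. embed m (f m)))\<^sup>2 = (\<Sum>m\<in>I. (norm (embed m (f m)))\<^sup>2)"
  using assms
  by (intro norm_sum_Pythagorean)
     (auto simp: pairwise_def orthogonal_def embed_def inner_add_left inner_add_right orth)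

text \<open>
  Left multiplication by an imaginary unit in a block of weight \<open>b n \<ge> 1\<close> enlarges only the component along
  \<open>e n 0\<close>, which it moves into the part scaled by \<open>b n\<close>. On the other three components it
  is the sum of a cross product, which preserves that part, and of an inner product, which goes to the
  unscaled component.
\<close>

lemma norm_imaginary_mult:
  assumes p: "imaginary_unit p" and lo: "1 \<le> lo" "b n \<le> lo \<or> qre q = 0"
  shows "(norm (embed n (p * q)))\<^sup>2 \<le> lo\<^sup>2 * (norm (embed n q))\<^sup>2"
proof -
  obtain p1 p2 p3 where p': "p = Quat 0 p1 p2 p3" "p1\<^sup>2 + p2\<^sup>2 + p3\<^sup>2 = 1"
    using p by (cases p) (auto simp: imaginary_unit_def)
  obtain t x y z where q': "q = Quat t x y z" by (cases q)
  define s where "s = (p1 * x + p2 * y + p3 * z)\<^sup>2"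
  define c where "c = (b n)\<^sup>2"
  \<comment> \<open>Multiplicativity of the quaternion norm; \<open>s\<close> is the square of the real part of \<open>p * q\<close>.\<close>
  have "(p1 * t + p2 * z - p3 * y)\<^sup>2 + (p2 * t + p3 * x - p1 * z)\<^sup>2 + (p3 * t + p1 * y - p2 * x)\<^sup>2 + s
     = (p1\<^sup>2 + p2\<^sup>2 + p3\<^sup>2) * (t\<^sup>2 + x\<^sup>2 + y\<^sup>2 + z\<^sup>2)"
    unfolding s_def by (simp add: power2_eq_square algebra_simps)
  then have cross: "(p1 * t + p2 * z - p3 * y)\<^sup>2 + (p2 * t + p3 * x - p1 * z)\<^sup>2 + (p3 * t + p1 * y - p2 * x)\<^sup>2
     = t\<^sup>2 + x\<^sup>2 + y\<^sup>2 + z\<^sup>2 - s"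
    using p'(2) by simp
  have "(norm (embed n (p * q)))\<^sup>2 = s + c *
    ((p1 * t + p2 * z - p3 * y)\<^sup>2 + (p2 * t + p3 * x - p1 * z)\<^sup>2 + (p3 * t + p1 * y - p2 * x)\<^sup>2)"
    unfolding norm_embed p' q' times_quaternion_def s_def c_def
    by (simp add: power2_eq_square algebra_simps)
  also have "\<dots> = c * t\<^sup>2 + c * (x\<^sup>2 + y\<^sup>2 + z\<^sup>2) - (c - 1) * s"
    unfolding cross by (simp add: algebra_simps)
  also have "\<dots> \<le> c * t\<^sup>2 + c * (x\<^sup>2 + y\<^sup>2 + z\<^sup>2)"
    using weight_ge_1[of n] by (simp add: c_def s_def)
  also have "\<dots> \<le> lo\<^sup>2 * t\<^sup>2 + lo\<^sup>2 * (c * (x\<^sup>2 + y\<^sup>2 + z\<^sup>2))"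
  proof (rule add_mono)
    show "c * t\<^sup>2 \<le> lo\<^sup>2 * t\<^sup>2"
    proof (cases "t = 0")
      case False
      then have "b n \<le> lo" using lo(2) q' by simp
      then show ?thesis
        unfolding c_def using weight_ge_1[of n] by (intro mult_right_mono power_mono) auto
    qed simp
    have "1 \<le> lo\<^sup>2" using lo(1) by simp
    moreover have "0 \<le> c * (x\<^sup>2 + y\<^sup>2 + z\<^sup>2)" by (simp add: c_def)
    ultimately show "c * (x\<^sup>2 + y\<^sup>2 + z\<^sup>2) \<le> lo\<^sup>2 * (c * (x\<^sup>2 + y\<^sup>2 + z\<^sup>2))"
      using mult_right_mono[of 1 "lo\<^sup>2" "c * (x\<^sup>2 + y\<^sup>2 + z\<^sup>2)"] by simp
  qed
  also have "\<dots> = lo\<^sup>2 * (norm (embed n q))\<^sup>2"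
    by (simp add: norm_embed q' c_def algebra_simps)
  finally show ?thesis .
qed

lemma norm_imaginary_mult_sum:
  assumes "imaginary_unit p" "1 \<le> lo" "finite I" "\<And>m. m \<in> I \<Longrightarrow> b m \<le> lo \<or> qre (f m) = 0"
  shows "norm (\<Sum>m\<in>I. embed m (p * f m)) \<le> lo * norm (\<Sum>m\<in>I. embed m (f m))"
proof (rule power2_le_imp_le)
  show "(norm (\<Sum>m\<in>I. embed m (p * f m)))\<^sup>2 \<le> (lo * norm (\<Sum>m\<in>I. embed m (f m)))\<^sup>2"
    unfolding power_mult_distrib norm_sum_embed[OF \<open>finite I\<close>] sum_distrib_left
    using assms by (intro sum_mono norm_imaginary_mult) auto
qed (use assms in simp)

text \<open>
  The unit vector to which left multiplication by the imaginary unit \<open>p\<close> sends \<open>e n 0\<close>, up to the factor \<open>b n\<close>.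
\<close>

definition direction :: "quaternion \<Rightarrow> nat \<Rightarrow> 'h" where
  "direction p n = qi p *\<^sub>R e n 1 + qj p *\<^sub>R e n 2 + qk p *\<^sub>R e n 3"

lemma inner_direction:
  assumes "imaginary_unit p" "coord n w = p * coord n z"
  shows "w \<bullet> direction p n = b n * (z \<bullet> e n 0)"
proof -
  have p: "qre p = 0" "(qi p)\<^sup>2 + (qj p)\<^sup>2 + (qk p)\<^sup>2 = 1"
    using assms(1) by (auto simp: imaginary_unit_def)
  have "w \<bullet> e n 1 = b n * qi (coord n w)"
     "w \<bullet> e n 2 = b n * qj (coord n w)" "w \<bullet> e n 3 = b n * qk (coord n w)"
    by (simp_all add: coord_def)
  then have "w \<bullet> direction p n = b n * (qi p * qi (coord n w) + qj p * qj (coord n w) + qk p * qk (coord n w))"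
    by (simp add: direction_def inner_add_right algebra_simps)
  also have "\<dots> = b n * (((qi p)\<^sup>2 + (qj p)\<^sup>2 + (qk p)\<^sup>2) * qre (coord n z))"
    unfolding assms(2) times_quaternion_def using p(1) by (simp add: power2_eq_square algebra_simps)
  finally show ?thesis using p(2) by (simp add: coord_def)
qed

text \<open>
  The vector \<open>w\<close>, the left multiple of \<open>z\<close>, is tested against the combination \<open>g\<close> of the orthonormal
  vectors \<open>direction p n\<close> with coefficients \<open>(z \<bullet> e n 0) / b n\<close>: the inner product is the squared norm
  of the part of \<open>z\<close> in question, while \<open>g\<close> is shorter than that part by at least the factor \<open>hi\<close>.
\<close>

lemma norm_large_part:
  assumes p: "imaginary_unit p" and w: "\<And>n. coord n w = p * coord n z"
    and G: "finite G" "\<And>n. n \<in> G \<Longrightarrow> hi \<le> b n" and hi: "0 < hi"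
  shows "hi * norm (\<Sum>n\<in>G. (z \<bullet> e n 0) *\<^sub>R e n 0) \<le> norm w"
proof -
  define s where "s = (\<Sum>n\<in>G. (z \<bullet> e n 0)\<^sup>2)"
  define g where "g = (\<Sum>n\<in>G. ((z \<bullet> e n 0) / b n) *\<^sub>R direction p n)"
  have pu: "(qi p)\<^sup>2 + (qj p)\<^sup>2 + (qk p)\<^sup>2 = 1" using p by (simp add: imaginary_unit_def)
  have nd: "(norm (direction p n))\<^sup>2 = 1" for n
    unfolding pu[symmetric] direction_def power2_norm_eq_inner
    by (simp add: inner_add_left inner_add_right orth power2_eq_square)
  have s: "(norm (\<Sum>n\<in>G. (z \<bullet> e n 0) *\<^sub>R e n 0))\<^sup>2 = s"
  proof -
    have "(norm (\<Sum>n\<in>G. (z \<bullet> e n 0) *\<^sub>R e n 0))\<^sup>2 = (\<Sum>n\<in>G. (norm ((z \<bullet> e n 0) *\<^sub>R e n 0))\<^sup>2)"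
      using G(1) by (intro norm_sum_Pythagorean) (auto simp: pairwise_def orthogonal_def orth)
    also have "\<dots> = s"
      unfolding s_def by (intro sum.cong) (simp_all add: norm_eq_sqrt_inner orth)
    finally show ?thesis .
  qed
  have "(norm g)\<^sup>2 = (\<Sum>n\<in>G. (norm (((z \<bullet> e n 0) / b n) *\<^sub>R direction p n))\<^sup>2)"
    unfolding g_def using G(1)
    by (intro norm_sum_Pythagorean)
       (auto simp: pairwise_def orthogonal_def direction_def inner_add_left inner_add_right orth)
  also have "\<dots> = (\<Sum>n\<in>G. ((z \<bullet> e n 0) / b n)\<^sup>2)"
    unfolding norm_scaleR power_mult_distrib nd by (simp add: power_divide)
  also have "\<dots> \<le> (\<Sum>n\<in>G. (z \<bullet> e n 0)\<^sup>2 / hi\<^sup>2)"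
    unfolding power_divide using G(2) hi
    by (intro sum_mono divide_left_mono power_mono) auto
  also have "\<dots> = s / hi\<^sup>2" by (simp add: s_def sum_divide_distrib)
  finally have g: "(norm g)\<^sup>2 \<le> s / hi\<^sup>2" .
  have "w \<bullet> g = (\<Sum>n\<in>G. (z \<bullet> e n 0) / b n * (b n * (z \<bullet> e n 0)))"
    unfolding g_def by (simp add: inner_sum_right inner_direction[OF p w])
  then have "w \<bullet> g = s" by (simp add: s_def power2_eq_square)
  then have "s \<le> norm w * norm g" using norm_cauchy_schwarz[of w g] by simp
  moreover have "0 \<le> s" unfolding s_def by (intro sum_nonneg) simp
  ultimately have "s\<^sup>2 \<le> (norm w)\<^sup>2 * (norm g)\<^sup>2"
    using power_mono[of s "norm w * norm g" 2] by (simp add: power_mult_distrib)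
  also have "\<dots> \<le> (norm w)\<^sup>2 * (s / hi\<^sup>2)" by (intro mult_left_mono g) simp
  finally have "s * (hi\<^sup>2 * s) \<le> s * (norm w)\<^sup>2"
    using hi by (simp add: field_simps power2_eq_square)
  then have "hi\<^sup>2 * s \<le> (norm w)\<^sup>2"
    using \<open>0 \<le> s\<close> by (cases "s = 0") auto
  then show ?thesis
    by (intro power2_le_imp_le[OF _ norm_ge_zero]) (simp add: power_mult_distrib s)
qed

end

section \<open>Similarity and weights\<close>
lemma finite_rank_space_transport:
  fixes T S :: "'a::banach \<Rightarrow>\<^sub>L 'a"
  assumes TS: "T o\<^sub>L S = id_blinfun" "S o\<^sub>L T = id_blinfun"
    and img: "\<And>A. A \<in> \<A> \<Longrightarrow> T o\<^sub>L A o\<^sub>L S \<in> \<B>"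
  shows "A \<in> finite_rank_part \<A> \<Longrightarrow> T o\<^sub>L A o\<^sub>L S \<in> finite_rank_part \<B>"
    and "x \<in> finite_rank_space \<A> \<Longrightarrow> T x \<in> finite_rank_space \<B>"
proof -
  have lin: "linear (blinfun_apply T)" by (simp add: blinfun.bounded_linear_right bounded_linear.linear)
  have ST: "S (T y) = y" for y
    using arg_cong[OF TS(2), of "\<lambda>f. blinfun_apply f y"] by simp
  show fr: "T o\<^sub>L A o\<^sub>L S \<in> finite_rank_part \<B>" if "A \<in> finite_rank_part \<A>" for A
  proof -
    have "range S = UNIV" using ST by (metis surjI)
    then have "range (T o\<^sub>L A o\<^sub>L S) = T ` range A"
      by (metis (no_types, lifting) blinfun_apply_blinfun_compose image_cong image_image)
    then show ?thesis
      using that img finite_dim_linear_image[OF lin] by (auto simp: finite_rank_part_def)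
  qed
  show "T x \<in> finite_rank_space \<B>" if "x \<in> finite_rank_space \<A>" for x
  proof -
    have "T ` span {blinfun_apply A u |A u. A \<in> finite_rank_part \<A>} \<subseteq> span {blinfun_apply A u |A u. A \<in> finite_rank_part \<B>}"
      unfolding linear_span_image[OF lin, symmetric]
    proof (intro span_mono subsetI)
      fix y assume "y \<in> T ` {blinfun_apply A u |A u. A \<in> finite_rank_part \<A>}"
      then obtain A u where A: "A \<in> finite_rank_part \<A>" and y: "y = T (blinfun_apply A u)" by auto
      have "y = (T o\<^sub>L A o\<^sub>L S) (T u)" by (simp add: y ST)
      with fr[OF A] show "y \<in> {blinfun_apply A u |A u. A \<in> finite_rank_part \<B>}" by blast
    qed
    with that show ?thesis unfolding finite_rank_space_def by blast
  qed
qed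

lemma commutant_transport:
  fixes T S :: "'a::banach \<Rightarrow>\<^sub>L 'a"
  assumes TS: "T o\<^sub>L S = id_blinfun" "S o\<^sub>L T = id_blinfun"
    and img: "(\<lambda>A. T o\<^sub>L A o\<^sub>L S) ` \<A> = \<B>"
    and D: "D \<in> finite_rank_commutant \<A>"
  shows "(\<lambda>x\<in>finite_rank_space \<B>. T (D (S x))) \<in> finite_rank_commutant \<B>"
proof -
  let ?X = "finite_rank_space \<A>" and ?Y = "finite_rank_space \<B>"
  have TS': "T (S y) = y" and ST': "S (T y) = y" for y
    using arg_cong[OF TS(1), of "\<lambda>f. blinfun_apply f y"] arg_cong[OF TS(2), of "\<lambda>f. blinfun_apply f y"] by simp_all
  have inv_img: "S o\<^sub>L B o\<^sub>L T \<in> \<A>" if B: "B \<in> \<B>" for B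
  proof -
    obtain A where "A \<in> \<A>" "B = T o\<^sub>L A o\<^sub>L S" using img B by blast
    moreover from this have "S o\<^sub>L B o\<^sub>L T = A" by (intro blinfun_eqI) (simp add: ST')
    ultimately show ?thesis by simp
  qed
  have TX: "T x \<in> ?Y" if "x \<in> ?X" for x
    by (rule finite_rank_space_transport(2)[OF TS _ that]) (use img in blast)
  have SY: "S y \<in> ?X" if "y \<in> ?Y" for y
    by (rule finite_rank_space_transport(2)[OF TS(2,1) inv_img that])
  have SA: "S o\<^sub>L B o\<^sub>L T \<in> finite_rank_part \<A>" if "B \<in> finite_rank_part \<B>" for B
    by (rule finite_rank_space_transport(1)[OF TS(2,1) inv_img that])
  have Dadd: "D (x + y) = D x + D y" if "x \<in> ?X" "y \<in> ?X" for x y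
    using D that unfolding finite_rank_commutant_def by blast
  have Dprops: "D x \<in> ?X" "D (r *\<^sub>R x) = r *\<^sub>R D x"
      "A \<in> finite_rank_part \<A> \<Longrightarrow> D (A x) = A (D x)" if "x \<in> ?X" for x r A
    using D that unfolding finite_rank_commutant_def by blast+
  have sub: "subspace ?Y" unfolding finite_rank_space_def by (rule subspace_span)
  have BY: "B y \<in> ?Y" if "B \<in> finite_rank_part \<B>" for B y
    unfolding finite_rank_space_def by (rule span_base) (use that in blast)
  have "T (D (S (B y))) = B (T (D (S y)))" if "B \<in> finite_rank_part \<B>" "y \<in> ?Y" for B y
  proof -
    have "S (B y) = (S o\<^sub>L B o\<^sub>L T) (S y)" by (simp add: TS')
    also have "D \<dots> = (S o\<^sub>L B o\<^sub>L T) (D (S y))"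
      using Dprops(3)[OF SY[OF that(2)] SA[OF that(1)]] .
    finally show ?thesis by (simp add: TS')
  qed
  then show ?thesis
    unfolding finite_rank_commutant_def
    by (auto simp: TX SY Dadd Dprops subspace_add[OF sub] subspace_scale[OF sub] BY blinfun.add_right blinfun.scaleR_right)
qed

text \<open>
  If \<open>b k\<close> lies far inside a gap between \<open>lo\<close> and \<open>hi\<close> that contains no weight of the
  second algebra, the bracket on the right is small, so the bound \<open>C\<close> for the norms of the similarity and of
  its inverse must be large.
\<close>

lemma similar_weights_bound:
  fixes e :: "nat \<Rightarrow> nat \<Rightarrow> 'h::{real_inner,banach}"
  assumes "quaternion_frame e b" "quaternion_frame e b'"
    and TS: "T o\<^sub>L S = id_blinfun" "S o\<^sub>L T = id_blinfun"
    and img: "(\<lambda>A. T o\<^sub>L A o\<^sub>L S) ` quaternion_frame.commuting_operators e b = quaternion_frame.commuting_operators e b'"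
    and C: "norm T \<le> C" "norm S \<le> C"
    and gap: "\<And>m. b' m \<le> lo \<or> hi \<le> b' m" "1 \<le> lo" "0 < hi"
  shows "1 \<le> C\<^sup>2 * (lo / b k + b k / hi)"
proof -
  interpret A: quaternion_frame e b by fact
  interpret B: quaternion_frame e b' by fact
  have TS': "T (S y) = y" and ST': "S (T y) = y" for y
    using arg_cong[OF TS(1), of "\<lambda>f. blinfun_apply f y"] arg_cong[OF TS(2), of "\<lambda>f. blinfun_apply f y"] by simp_all
  have "0 \<le> C" using C(1) norm_ge_zero order_trans by blast
  have Tn: "norm (T x) \<le> C * norm x" and Sn: "norm (S x) \<le> C * norm x" for x
    using norm_blinfun[of T x] norm_blinfun[of S x] C mult_right_mono[OF _ norm_ge_zero[of x]] order_trans by blast+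
  have TX: "T x \<in> B.XF" if "x \<in> A.XF" for x
    by (rule finite_rank_space_transport(2)[OF TS _ that]) (use img in blast)
  have SX: "S x \<in> A.XF" if "x \<in> B.XF" for x
  proof (rule finite_rank_space_transport(2)[OF TS(2,1) _ that])
    fix Z assume "Z \<in> B.commuting_operators"
    then obtain Y where "Y \<in> A.commuting_operators" "Z = T o\<^sub>L Y o\<^sub>L S" using img by blast
    moreover from this have "S o\<^sub>L Z o\<^sub>L T = Y" by (intro blinfun_eqI) (simp add: ST')
    ultimately show "S o\<^sub>L Z o\<^sub>L T \<in> A.commuting_operators" by simp
  qed
  define i where "i = Quat 0 1 0 0"
  have i: "i * i = - 1" "imaginary_unit i"
    unfolding i_def by (simp_all add: quaternion_units(1) imaginary_unitI)
  define J where "J = A.left i"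
  define J' where "J' = (\<lambda>x\<in>B.XF. T (J (S x)))"
  have JJ: "J (J x) = - x" if "x \<in> A.XF" for x
    by (rule A.coord_eqI) (simp add: J_def A.coord_left A.left_in_XF that i(1) A.coord_simps linear_neg[OF A.linear_coord] flip: mult.assoc)
  have "J' \<in> finite_rank_commutant B.commuting_operators"
    unfolding J'_def J_def by (rule commutant_transport[OF TS img A.left_in_commutant])
  then obtain p where p: "J' = B.left p" using B.commutant_is_left by blast
  have J'T: "J' (T x) = T (J x)" if "x \<in> A.XF" for x
    using that by (simp add: J'_def TX ST')
  have "imaginary_unit p"
  proof (rule imaginary_unitI)
    let ?u = "B.embed 0 1"
    have u: "?u \<in> B.XF" "S ?u \<in> A.XF" by (simp_all add: B.embed_in_XF SX)
    have "J' (J' ?u) = J' (T (J (S ?u)))" using u by (simp add: J'_def)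
    also have "\<dots> = T (J (J (S ?u)))" by (rule J'T) (simp add: J_def A.left_in_XF u)
    also have "\<dots> = - ?u" using u by (simp add: JJ blinfun.minus_right TS')
    finally have "B.coord 0 (J' (J' ?u)) = - B.coord 0 ?u"
      by (simp add: linear_neg[OF B.linear_coord])
    then show "p * p = - 1"
      by (simp add: p B.coord_left B.left_in_XF u B.coord_embed)
  qed
  define w where "w = T (A.embed k 1)"
  have wX: "w \<in> B.XF" unfolding w_def by (intro TX A.embed_in_XF)
  have normJ'w: "norm (J' w) \<le> C * b k"
  proof -
    have "J (A.embed k 1) = A.embed k i"
      unfolding J_def by (rule A.left_eqI[symmetric]) (simp_all add: A.embed_in_XF A.coord_embed)
    moreover have "norm (A.embed k i) = b k"
    proof -
      have "(norm (A.embed k i))\<^sup>2 = (b k)\<^sup>2" by (simp add: A.norm_embed i_def)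
      then show ?thesis using A.weight_pos(1)[of k] by (simp add: power2_eq_iff_nonneg)
    qed
    ultimately show ?thesis
      using Tn[of "A.embed k i"] by (simp add: w_def J'T A.embed_in_XF)
  qed
  \<comment> \<open>The splitting of \<open>w\<close> may leave the domain of \<open>J'\<close>; its truncations to finitely many blocks do not.\<close>
  define P where "P N = (\<Sum>m<N. B.embed m (B.coord m w))" for N
  have bound: "S (P N) \<bullet> e k 0 \<le> C * lo * norm (P N) / b k + C\<^sup>2 * b k / hi" for N
  proof -
    \<comment> \<open>\<open>v\<close> is the part of the truncation that \<open>J'\<close> stretches by \<open>hi\<close> at least, \<open>u\<close> the rest.\<close>
    define G where "G = {m. m < N \<and> \<not> b' m \<le> lo}"
    define v where "v = (\<Sum>m\<in>G. (w \<bullet> e m 0) *\<^sub>R e m 0)"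
    define f where "f m = (if m \<in> G then B.coord m w - Quat (w \<bullet> e m 0) 0 0 0 else B.coord m w)" for m
    define u where "u = (\<Sum>m<N. B.embed m (f m))"
    have "G \<subseteq> {..<N}" by (auto simp: G_def)
    have "P N - u = (\<Sum>m<N. if m \<in> G then (w \<bullet> e m 0) *\<^sub>R e m 0 else 0)"
      unfolding P_def u_def sum_subtractf[symmetric] f_def
      by (intro sum.cong refl) (simp add: B.embed_simps, simp add: B.embed_def)
    also have "\<dots> = v"
      unfolding v_def using \<open>G \<subseteq> {..<N}\<close> by (simp add: sum.inter_restrict[symmetric] Int_absorb1)
    finally have Puv: "P N = u + v" by (simp add: algebra_simps)
    have "finite G" by (simp add: G_def)
    have "hi * norm v \<le> norm (J' w)"
      unfolding v_def
    proof (rule B.norm_large_part[OF \<open>imaginary_unit p\<close> _ \<open>finite G\<close> _ gap(3)])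
      show "B.coord n (J' w) = p * B.coord n w" for n by (simp add: p B.coord_left wX)
      show "hi \<le> b' n" if "n \<in> G" for n using that gap(1)[of n] by (auto simp: G_def)
    qed
    then have "hi * norm v \<le> C * b k" using normJ'w by linarith
    then have v: "norm v \<le> C * b k / hi" using gap(3) by (simp add: pos_le_divide_eq mult.commute)
    have "norm u \<le> norm (P N)"
    proof (rule power2_le_imp_le)
      show "(norm u)\<^sup>2 \<le> (norm (P N))\<^sup>2"
        unfolding u_def P_def B.norm_sum_embed[OF finite_lessThan]
        by (intro sum_mono) (simp add: f_def B.norm_embed minus_quaternion_def B.coord_def)
    qed simp
    have uX: "u \<in> B.XF" unfolding u_def by (intro subspace_sum B.subspace_XF B.embed_in_XF)
    have J'u: "J' u = (\<Sum>m<N. B.embed m (p * f m))"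
      unfolding p
    proof (rule B.left_eqI[OF uX, symmetric])
      show "B.coord n (\<Sum>m<N. B.embed m (p * f m)) = p * B.coord n u" for n
        unfolding u_def B.coord_simps sum_distrib_left B.coord_embed by (intro sum.cong) auto
    qed
    have "norm (J' u) \<le> lo * norm u"
      unfolding J'u unfolding u_def
    proof (rule B.norm_imaginary_mult_sum[OF \<open>imaginary_unit p\<close> gap(2) finite_lessThan])
      show "b' m \<le> lo \<or> qre (f m) = 0" if "m \<in> {..<N}" for m
        using that by (auto simp: f_def G_def minus_quaternion_def B.coord_def)
    qed
    then have J'u_le: "norm (J' u) \<le> lo * norm (P N)"
      using \<open>norm u \<le> norm (P N)\<close> gap(2) by (meson mult_left_mono order_trans zero_le_one)
    have "J (S u) = S (J' u)" using uX by (simp add: J'_def ST')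
    have "J (S u) \<bullet> A.direction i k = b k * (S u \<bullet> e k 0)"
      by (rule A.inner_direction[OF i(2)]) (simp add: J_def A.coord_left SX uX)
    moreover have "A.direction i k = e k 1" by (simp add: A.direction_def i_def)
    moreover have "norm (e k 1) = 1" by (simp add: norm_eq_sqrt_inner A.orth)
    ultimately have "b k * (S u \<bullet> e k 0) \<le> norm (J (S u))"
      using norm_cauchy_schwarz[of "J (S u)" "e k 1"] by simp
    also have "\<dots> \<le> C * norm (J' u)" unfolding \<open>J (S u) = S (J' u)\<close> by (rule Sn)
    also have "\<dots> \<le> C * (lo * norm (P N))" by (intro mult_left_mono J'u_le \<open>0 \<le> C\<close>)
    finally have Su: "S u \<bullet> e k 0 \<le> C * lo * norm (P N) / b k"
      using A.weight_pos(1)[of k] by (simp add: pos_le_divide_eq algebra_simps)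
    have "S v \<bullet> e k 0 \<le> norm (S v)"
      using norm_cauchy_schwarz[of "S v" "e k 0"] by (simp add: norm_eq_sqrt_inner A.orth)
    also have "\<dots> \<le> C * norm v" by (rule Sn)
    also have "\<dots> \<le> C * (C * b k / hi)" by (intro mult_left_mono v \<open>0 \<le> C\<close>)
    finally have "S v \<bullet> e k 0 \<le> C\<^sup>2 * b k / hi" by (simp add: power2_eq_square)
    with Su show ?thesis by (simp add: Puv blinfun.add_right inner_add_left)
  qed
  have lim: "P \<longlonglongrightarrow> w" unfolding P_def by (rule B.block_expansion)
  have "S w \<bullet> e k 0 \<le> C * lo * norm w / b k + C\<^sup>2 * b k / hi"
  proof (rule LIMSEQ_le)
    show "(\<lambda>N. S (P N) \<bullet> e k 0) \<longlonglongrightarrow> S w \<bullet> e k 0"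
      by (intro tendsto_intros blinfun.tendsto lim)
    show "(\<lambda>N. C * lo * norm (P N) / b k + C\<^sup>2 * b k / hi) \<longlonglongrightarrow> C * lo * norm w / b k + C\<^sup>2 * b k / hi"
      by (intro tendsto_intros lim) simp
  qed (use bound in blast)
  moreover have "S w \<bullet> e k 0 = 1"
    by (simp add: w_def ST' A.embed_def one_quaternion_def A.orth)
  moreover have "norm (A.embed k 1) = 1"
    by (simp add: A.embed_def one_quaternion_def norm_eq_sqrt_inner A.orth)
  then have "norm w \<le> C" using Tn[of "A.embed k 1"] by (simp add: w_def)
  then have "C * lo * norm w / b k \<le> C * lo * C / b k"
    using A.weight_ge_1[of k] \<open>0 \<le> C\<close> gap(2) by (intro divide_right_mono mult_left_mono) auto
  ultimately show ?thesis by (simp add: power2_eq_square algebra_simps)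
qed

section \<open>A continuum of pairwise non-similar algebras\<close>
lemma ex_quaternion_frame:
  assumes inf: "\<not> finite_dim (UNIV :: 'h::{real_inner, banach} set)"
    and sep: "separable_space (euclidean :: 'h topology)"
  shows "\<exists>e :: nat \<Rightarrow> nat \<Rightarrow> 'h. \<forall>b. (\<forall>n. 1 \<le> b n) \<longrightarrow> quaternion_frame e b"
proof -
  obtain f :: "nat \<Rightarrow> 'h" where orth: "\<And>m n. f m \<bullet> f n = (if m = n then 1 else 0)"
    and sums: "\<And>x. (\<lambda>n. (x \<bullet> f n) *\<^sub>R f n) sums x"
    using ex_orthonormal_basis assms unfolding finite_dim_def by blast
  define e where "e n k = f (4 * n + k)" for n k
  have "quaternion_frame e b" if "\<forall>n. 1 \<le> b n" for b
  proof
    show "e m k \<bullet> e n l = (if m = n \<and> k = l then 1 else 0)" if "k < 4" "l < 4" for m n k l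
    proof -
      have "4 * m + k = 4 * n + l \<longleftrightarrow> m = n \<and> k = l" using that by presburger
      then show ?thesis by (simp add: e_def orth)
    qed
    show "(\<lambda>N. \<Sum>n<N. \<Sum>k<4. (x \<bullet> e n k) *\<^sub>R e n k) \<longlonglongrightarrow> x" for x
    proof -
      have eq: "(\<Sum>n<N. \<Sum>k<4. (x \<bullet> e n k) *\<^sub>R e n k) = (\<Sum>i<4 * N. (x \<bullet> f i) *\<^sub>R f i)" for N
        by (induction N) (simp_all add: e_def eval_nat_numeral)
      have "(\<lambda>M. \<Sum>i<M. (x \<bullet> f i) *\<^sub>R f i) \<longlonglongrightarrow> x"
        using sums[of x] by (simp add: sums_def)
      then have "((\<lambda>M. \<Sum>i<M. (x \<bullet> f i) *\<^sub>R f i) \<circ> (\<lambda>N. 4 * N)) \<longlonglongrightarrow> x"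
        by (rule LIMSEQ_subseq_LIMSEQ) (simp add: strict_mono_def)
      then show ?thesis by (simp add: eq comp_def)
    qed
    show "1 \<le> b n" for n using that by simp
  qed
  then show ?thesis by blast
qed

text \<open>
  Two distinct real numbers share only finitely many of the pairs coded here, because the floors of
  \<open>n * x\<close> and \<open>n * y\<close> differ as soon as \<open>n * \<bar>x - y\<bar> \<ge> 1\<close>.
\<close>

definition levels :: "real \<Rightarrow> nat set" where
  "levels x = range (\<lambda>n::nat. to_nat (n, \<lfloor>real n * x\<rfloor>))"

definition weight :: "real \<Rightarrow> nat \<Rightarrow> real" where
  "weight x n = (if n \<in> levels x then fact n else 1)"

lemma one_le_weight: "1 \<le> weight x n"
  by (simp add: weight_def)

lemma infinite_levels_diff:
  assumes "x \<noteq> y"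
  shows "infinite (levels x - levels y)"
proof -
  define h where "h n = to_nat (n, \<lfloor>real n * x\<rfloor>)" for n :: nat
  obtain N :: nat where N: "1 / \<bar>x - y\<bar> < real N" using reals_Archimedean2 by blast
  have "h n \<notin> levels y" if "n \<ge> N" for n
  proof
    assume "h n \<in> levels y"
    then have "\<lfloor>real n * x\<rfloor> = \<lfloor>real n * y\<rfloor>" by (auto simp: h_def levels_def)
    then have "\<bar>real n * x - real n * y\<bar> < 1" by linarith
    moreover have "\<bar>real n * x - real n * y\<bar> = real n * \<bar>x - y\<bar>"
      by (simp add: abs_mult flip: right_diff_distrib)
    moreover have "1 < real N * \<bar>x - y\<bar>" using N assms by (simp add: pos_divide_less_eq)
    moreover have "real N * \<bar>x - y\<bar> \<le> real n * \<bar>x - y\<bar>"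
      using that by (intro mult_right_mono) auto
    ultimately show False by linarith
  qed
  then have "h ` {N..} \<subseteq> levels x - levels y" by (auto simp: h_def levels_def)
  moreover have "inj_on h {N..}" by (auto simp: inj_on_def h_def)
  then have "infinite (h ` {N..})" by (simp add: finite_image_iff infinite_Ici)
  ultimately show ?thesis using finite_subset by blast
qed

text \<open>
  At an index \<open>k\<close> that belongs to \<open>levels x\<close> but not to \<open>levels y\<close>, the weight \<open>k!\<close> sits in the gap
  between \<open>(k - 1)!\<close> and \<open>(k + 1)!\<close> of the weights for \<open>y\<close>, and both relative distances grow with \<open>k\<close>.
\<close>

lemma not_similar_weights:
  fixes e :: "nat \<Rightarrow> nat \<Rightarrow> 'h::{real_inner,banach}"
  assumes frame: "\<And>x. quaternion_frame e (weight x)" and "x \<noteq> y"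
  shows "\<not> similar_algebras (quaternion_frame.commuting_operators e (weight x)) (quaternion_frame.commuting_operators e (weight y))"
proof
  assume "similar_algebras (quaternion_frame.commuting_operators e (weight x)) (quaternion_frame.commuting_operators e (weight y))"
  then obtain T S :: "'h \<Rightarrow>\<^sub>L 'h" where TS: "T o\<^sub>L S = id_blinfun" "S o\<^sub>L T = id_blinfun"
    and img: "(\<lambda>A. T o\<^sub>L A o\<^sub>L S) ` quaternion_frame.commuting_operators e (weight x) = quaternion_frame.commuting_operators e (weight y)"
    unfolding similar_algebras_def by blast
  define C where "C = norm T + norm S"
  obtain M :: nat where M: "2 * C\<^sup>2 < real M" using reals_Archimedean2 by blast
  obtain k where k: "k \<in> levels x" "k \<notin> levels y" "M < k"
    using infinite_levels_diff[OF \<open>x \<noteq> y\<close>] unfolding infinite_nat_iff_unbounded by blast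
  then obtain j where j: "k = Suc j" by (cases k) auto
  have "1 \<le> C\<^sup>2 * (fact j / weight x k + weight x k / fact (Suc k))"
  proof (rule similar_weights_bound[OF frame frame TS img])
    show "norm T \<le> C" "norm S \<le> C" by (simp_all add: C_def)
    show "weight y m \<le> fact j \<or> fact (Suc k) \<le> weight y m" for m
    proof (cases "m \<in> levels y")
      case True
      then have "m \<le> j \<or> Suc k \<le> m" using k(2) j by (metis not_less_eq_eq le_antisym)
      then show ?thesis using True by (auto simp: weight_def intro: fact_mono simp del: fact_Suc)
    qed (simp add: weight_def)
    show "1 \<le> (fact j :: real)" by simp
    show "0 < (fact (Suc k) :: real)" by (rule fact_gt_zero)
  qed
  also have "fact j / weight x k + weight x k / fact (Suc k) = 1 / real k + 1 / real (Suc k)"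
  proof -
    have w: "weight x k = real k * fact j"
      using k(1) by (simp add: weight_def j)
    then have "fact j / weight x k = 1 / real k" by simp
    moreover have "fact (Suc k) = real (Suc k) * weight x k"
      using k(1) by (simp add: weight_def)
    then have "weight x k / fact (Suc k) = 1 / real (Suc k)"
      using one_le_weight[of x k] by (simp del: of_nat_Suc)
    ultimately show ?thesis by simp
  qed
  also have "C\<^sup>2 * \<dots> \<le> C\<^sup>2 * (2 / real k)"
  proof (rule mult_left_mono)
    have "1 / real (Suc k) \<le> 1 / real k" using k(3) by (intro divide_left_mono) auto
    then show "1 / real k + 1 / real (Suc k) \<le> 2 / real k" by simp
  qed simp
  also have "\<dots> < 1"
    using M k(3) by (simp add: divide_less_eq)
  finally show False by simp
qed

theorem corollary4p10:
  assumes infinite_dimensional: "\<not> finite_dim (UNIV :: 'h::{real_inner, banach} set)"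
    and separable: "separable_space (euclidean :: 'h topology)"
  shows "\<exists>\<F> :: ('h \<Rightarrow>\<^sub>L 'h) set set.
           \<F> \<approx> (UNIV :: real set) \<and>
           (\<forall>\<A>\<in>\<F>. lomonosov_algebra \<A> \<and> quaternion_type \<A>) \<and>
           pairwise (\<lambda>\<A> \<B>. \<not> similar_algebras \<A> \<B>) \<F>"
proof -
  obtain e :: "nat \<Rightarrow> nat \<Rightarrow> 'h" where frame: "\<And>x. quaternion_frame e (weight x)"
    using ex_quaternion_frame[OF assms] one_le_weight by blast
  define alg where "alg x = quaternion_frame.commuting_operators e (weight x)" for x
  have not_similar: "\<not> similar_algebras (alg x) (alg y)" if "x \<noteq> y" for x y
    unfolding alg_def by (rule not_similar_weights[OF frame that])
  have "similar_algebras (alg x) (alg x)" for x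
  proof -
    have "id_blinfun o\<^sub>L A o\<^sub>L id_blinfun = A" for A :: "'h \<Rightarrow>\<^sub>L 'h"
      by (rule blinfun_eqI) simp
    moreover have "id_blinfun o\<^sub>L id_blinfun = (id_blinfun :: 'h \<Rightarrow>\<^sub>L 'h)"
      by (rule blinfun_eqI) simp
    ultimately show ?thesis
      unfolding similar_algebras_def by (intro exI[of _ id_blinfun]) simp
  qed
  then have "inj alg" using not_similar by (metis injI)
  then have "range alg \<approx> (UNIV :: real set)"
    by (rule inj_on_image_eqpoll_self)
  moreover have "lomonosov_algebra (alg x) \<and> quaternion_type (alg x)" for x
    unfolding alg_def using quaternion_frame.lomonosov_commuting_operators[OF frame] quaternion_frame.quaternion_type_commuting_operators[OF frame] by blast
  moreover have "pairwise (\<lambda>\<A> \<B>. \<not> similar_algebras \<A> \<B>) (range alg)"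
    using not_similar unfolding pairwise_def by (metis rangeE)
  ultimately show ?thesis by (intro exI[of _ "range alg"]) blast
qed

end
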